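(* In the adversarially corrupted stochastic model of the context, with corruption level $C$ and $\sigma=\sigma_{\mathscr D}$ the gradient standard deviation of the uncorrupted i.i.d. source, adaptive OFTRL enjoys, for $u\in\mathscr X$, the bound $$\mathbb E[R_T(u)]=O\big(D\sigma\sqrt T+D\sqrt{GC}\,\big).$$
   Context: Setting. $\mathscr X\subset\mathbb R^d$ is a closed and bounded convex set, $\|\cdot\|$ is the Euclidean norm, and $D=\sup_{x,y\in\mathscr X}\|x-y\|$. Adversarially corrupted stochastic model: there is a fixed distribution $\mathscr D$ and a function $h$. In each round $t=1,\dots,T$ the learner chooses $x_t\in\mathscr X$; the adversary selects a function $c_t$ on $\mathscr X$ (the adversarial part of the loss, possibly depending on past actions and realizations); $\xi_{\mathrm{iid},t}\sim\mathscr D$ is drawn i.i.d.; and with $\xi_t=(\xi_{\mathrm{iid},t},c_t)\sim\mathscr D\otimes\delta_{c_t}$ ($\delta_{c_t}$ the Dirac measure at $c_t$) the loss function is $$f(x,\xi_t)=h(x,\xi_{\mathrm{iid},t})+c_t(x).$$ The corruption level $C>0$ bounds the total perturbation: $\sum_{t=1}^T\max_{x\in\mathscr X}\|\nabla c_t(x)\|\le C$. Put $F(x)=\mathbb E_{\xi\sim\mathscr D}[h(x,\xi)]$ and $F^t=F+c_t$ (the expected loss in round $t$), and $$\sigma_{\mathscr D}^2=\max_{x\in\mathscr X}\mathbb E_{\xi\sim\mathscr D}\|\nabla h(x,\xi)-\nabla F(x)\|^2.$$ Assumptions: (A1) $f(\cdot,\xi_t)$ is convex and its gradients are bounded in norm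 by $G$ almost surely; (A2) the expected losses $F^t$ are $L$-smooth, i.e. $\nabla F^t$ is $L$-Lipschitz continuous; (A3) $\mathbb E_{\xi\sim\mathscr D}\|\nabla h(x,\xi)-\nabla F(x)\|^2$ is finite for every $x\in\mathscr X$. Adaptive OFTRL (Optimistic Follow-the-Regularised-Leader): with $g_t=\nabla f(x_t,\xi_t)$, optimistic predictions $M_t=g_{t-1}$ (and $M_1=0$), a user-specified parameter $\nu>0$ and step sizes $\eta_t=D^2/\big(\nu+\sum_{s=1}^{t-1}\eta_s\|g_s-M_s\|^2\big)$, $$x_t=\operatorname*{argmin}_{x\in\mathscr X}\Big\{\Big\langle x,\,M_t+\sum_{s=1}^{t-1}g_s\Big\rangle+\frac{\|x\|^2}{\eta_t}\Big\}.$$ Regret (measured against the perturbed losses): $R_T(u)=\sum_{t=1}^T\langle g_t,x_t-u\rangle$ for $u\in\mathscr X$; $\mathbb E$ is the expectation over all randomness. *)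

theory Defs
  imports "HOL-Probability.Probability"
begin

section \<open>Gradients on a constraint set\<close>

text \<open>
  The losses are functions on \<open>X\<close> only, so differentiability is taken within \<open>X\<close>. The gradient field
  is an explicit argument because the derivative within \<open>X\<close> determines the gradient uniquely only
  if \<open>X\<close> has nonempty interior; if \<open>X\<close> is lower-dimensional, any choice of gradient field is allowed
  (in particular the restriction of an ambient gradient).
\<close>

definition gradient_on ::
    "'a::euclidean_space set \<Rightarrow> ('a \<Rightarrow> real) \<Rightarrow> ('a \<Rightarrow> 'a) \<Rightarrow> bool" where
  "gradient_on X f f' \<longleftrightarrow> (\<forall>y\<in>X. (f has_derivative (\<lambda>v. f' y \<bullet> v)) (at y within X))"


section \<open>Adaptive optimistic follow-the-regularised-leader\<close>

definition prediction :: "(nat \<Rightarrow> 'a::euclidean_space) \<Rightarrow> nat \<Rightarrow> 'a" where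
  "prediction g t = (if t \<le> 1 then 0 else g (t - 1))"

text \<open>\<open>diam\<close> is the diameter of the constraint set, \<open>g s\<close> the gradient observed in round \<open>s\<close>.\<close>

fun step_size :: "real \<Rightarrow> real \<Rightarrow> (nat \<Rightarrow> 'a::euclidean_space) \<Rightarrow> nat \<Rightarrow> real" where
  "step_size diam \<nu> g t =
     diam\<^sup>2 / (\<nu> + (\<Sum>s\<in>{1..<t}. step_size diam \<nu> g s * (norm (g s - prediction g s))\<^sup>2))"

declare step_size.simps [simp del]

text \<open>
  Rounds are numbered from \<open>1\<close>. If \<open>X\<close> is a single point, then the step sizes are \<open>0\<close> and the
  regulariser is \<open>0\<close> by the convention \<open>z / 0 = 0\<close>; the minimiser is that point in any case.
\<close>

definition adaptive_oftrl ::
    "'a::euclidean_space set \<Rightarrow> real \<Rightarrow> nat \<Rightarrow> (nat \<Rightarrow> 'a) \<Rightarrow> (nat \<Rightarrow> 'a) \<Rightarrow> bool" where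
  "adaptive_oftrl X \<nu> T g x \<longleftrightarrow>
     (\<forall>t\<in>{1..T}.
        is_arg_min
          (\<lambda>y. y \<bullet> (prediction g t + (\<Sum>s\<in>{1..<t}. g s))
                + (norm y)\<^sup>2 / step_size (diameter X) \<nu> g t)
          (\<lambda>y. y \<in> X) (x t))"

definition regret ::
    "nat \<Rightarrow> (nat \<Rightarrow> 'a::euclidean_space) \<Rightarrow> (nat \<Rightarrow> 'a) \<Rightarrow> 'a \<Rightarrow> real" where
  "regret T g x u = (\<Sum>t\<in>{1..T}. g t \<bullet> (x t - u))"


section \<open>The adversarially corrupted stochastic model\<close>

text \<open>
  \<open>corrupted h s c y\<close> is \<open>f (y, (s, c)) = h (y, s) + c (y)\<close>. The definition is used both for losses
  (real values) and for their gradients (vector values).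
\<close>

definition corrupted :: "('a \<Rightarrow> 's \<Rightarrow> 'b::plus) \<Rightarrow> 's \<Rightarrow> ('a \<Rightarrow> 'b) \<Rightarrow> 'a \<Rightarrow> 'b" where
  "corrupted h s c y = h y s + c y"

lemma gradient_on_corrupted:
  assumes "gradient_on X (\<lambda>y. h y s) (\<lambda>y. h' y s)" and "gradient_on X c c'"
  shows "gradient_on X (corrupted h s c) (corrupted h' s c')"
  unfolding gradient_on_def
proof
  fix y assume "y \<in> X"
  then have "((\<lambda>y. h y s + c y) has_derivative (\<lambda>v. h' y s \<bullet> v + c' y \<bullet> v)) (at y within X)"
    using assms by (intro has_derivative_add) (auto simp: gradient_on_def)
  then show "(corrupted h s c has_derivative (\<lambda>v. corrupted h' s c' y \<bullet> v)) (at y within X)"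
    by (simp add: corrupted_def[abs_def] inner_add_left)
qed

definition expected_loss :: "'s measure \<Rightarrow> ('a \<Rightarrow> 's \<Rightarrow> real) \<Rightarrow> 'a \<Rightarrow> real" where
  "expected_loss D h y = (\<integral>s. h y s \<partial>D)"

definition gradient_sd ::
    "'s measure \<Rightarrow> 'a::euclidean_space set \<Rightarrow> ('a \<Rightarrow> 's \<Rightarrow> 'a) \<Rightarrow> ('a \<Rightarrow> 'a) \<Rightarrow> real" where
  "gradient_sd D X h' F' = sqrt (SUP y\<in>X. \<integral>s. (norm (h' y s - F' y))\<^sup>2 \<partial>D)"

text \<open>
  \<open>M\<close> carries all the randomness and \<open>Fil t\<close> is the information available after round \<open>t\<close>
  (\<open>Fil 0\<close> may contain private randomness of the adversary). The adversary's choice \<open>c t\<close> depends on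
  the past only, i.e. it is measurable with respect to \<open>Fil (t - 1)\<close>, whereas \<open>\<xi> t\<close> is a fresh sample
  from \<open>D\<close>, independent of \<open>Fil (t - 1)\<close>; so \<open>\<xi> 1, \<dots>, \<xi> T\<close> are i.i.d., and given the past,
  \<open>(\<xi> t, c t)\<close> is distributed as \<open>D\<close> times the Dirac measure at \<open>c t\<close>.
  The primed functions are the gradients (in \<open>y \<in> X\<close>) of the unprimed ones, and
  \<open>F'\<close> is the gradient of \<open>expected_loss D h\<close>.
\<close>

locale corrupted_stochastic_model =
  prob_space M + source: prob_space D + filtration "space M" Fil
  for M :: "'w measure" and D :: "'s measure" and Fil :: "nat \<Rightarrow> 'w measure" +
  fixes X :: "'a::euclidean_space set"
    and T :: nat
    and C G L :: real
    and \<xi> :: "nat \<Rightarrow> 'w \<Rightarrow> 's"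
    and h :: "'a \<Rightarrow> 's \<Rightarrow> real" and h' :: "'a \<Rightarrow> 's \<Rightarrow> 'a"
    and F' :: "'a \<Rightarrow> 'a"
    and c :: "nat \<Rightarrow> 'w \<Rightarrow> 'a \<Rightarrow> real" and c' :: "nat \<Rightarrow> 'w \<Rightarrow> 'a \<Rightarrow> 'a"
  assumes horizon: "1 \<le> T"
    and subalgebra_Fil: "\<And>t. subalgebra M (Fil t)"
    and sample_measurable: "\<And>t. t \<in> {1..T} \<Longrightarrow> \<xi> t \<in> measurable (Fil t) D"
    and sample_distr: "\<And>t. t \<in> {1..T} \<Longrightarrow> distr M D (\<xi> t) = D"
    and sample_indep: "\<And>t. t \<in> {1..T} \<Longrightarrow>
          indep_set (sets (Fil (t - 1))) (sets (vimage_algebra (space M) (\<xi> t) D))"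
    and h_integrable: "\<And>y. y \<in> X \<Longrightarrow> integrable D (h y)"
    and h_gradient: "AE s in D. gradient_on X (\<lambda>y. h y s) (\<lambda>y. h' y s)"
    and h'_measurable:
          "(\<lambda>(y, s). h' y s) \<in> borel_measurable (restrict_space borel X \<Otimes>\<^sub>M D)"
    and F_gradient: "gradient_on X (expected_loss D h) F'"
    and c_measurable: "\<And>t. t \<in> {1..T} \<Longrightarrow>
          (\<lambda>(w, y). c t w y) \<in> borel_measurable (Fil (t - 1) \<Otimes>\<^sub>M restrict_space borel X)"
    and c_gradient: "\<And>t. t \<in> {1..T} \<Longrightarrow> AE w in M. gradient_on X (c t w) (c' t w)"
    and c'_measurable: "\<And>t. t \<in> {1..T} \<Longrightarrow>
          (\<lambda>(w, y). c' t w y) \<in> borel_measurable (Fil (t - 1) \<Otimes>\<^sub>M restrict_space borel X)"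
    and corruption_pos: "0 < C"
    and corruption_bdd: "\<And>t. t \<in> {1..T} \<Longrightarrow>
          AE w in M. bdd_above ((\<lambda>y. norm (c' t w y)) ` X)"
    and corruption_level: "AE w in M. (\<Sum>t\<in>{1..T}. SUP y\<in>X. norm (c' t w y)) \<le> C"
    and loss_convex: "\<And>t. t \<in> {1..T} \<Longrightarrow>
          AE w in M. convex_on X (corrupted h (\<xi> t w) (c t w))"
    and loss_gradient_bound: "\<And>t. t \<in> {1..T} \<Longrightarrow>
          AE w in M. \<forall>y\<in>X. norm (corrupted h' (\<xi> t w) (c' t w) y) \<le> G"
    and smooth: "\<And>t. t \<in> {1..T} \<Longrightarrow>
          AE w in M. L-lipschitz_on X (\<lambda>y. F' y + c' t w y)"
    and finite_variance: "\<And>y. y \<in> X \<Longrightarrow> integrable D (\<lambda>s. (norm (h' y s - F' y))\<^sup>2)"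

end

theory Submission
  imports Defs
begin

text \<open>
  The regret of the algorithm is at most a multiple of \<open>S = D\<^sup>2 / \<eta>\<^sub>T\<^sub>+\<^sub>1\<close> minus a multiple of the squared path
  length \<open>\<Sum> \<parallel>x\<^sub>t - x\<^sub>t\<^sub>-\<^sub>1\<parallel>\<^sup>2\<close>, and \<open>S\<close> is of order \<open>D (\<Sum> \<parallel>g\<^sub>t - g\<^sub>t\<^sub>-\<^sub>1\<parallel>\<^sup>2)\<^sup>1\<^sup>/\<^sup>2\<close>. The difference \<open>g\<^sub>t - g\<^sub>t\<^sub>-\<^sub>1\<close> splits
  into the sampling noise of the two rounds, a smoothness term, which the path length absorbs, and the
  change of the adversarial gradient at \<open>x\<^sub>t\<^sub>-\<^sub>1\<close>. The latter is at most \<open>2 G\<close>, so its squares sum to at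
  most \<open>4 G C\<close>. Jensen's inequality for the noise gives the bound in expectation.
\<close>

section \<open>Regularised linear minimisation and adaptive step sizes\<close>

text \<open>Completing the square turns the objective into
  \<open>(norm (y + (\<eta> / 2) *\<^sub>R v))\<^sup>2 / \<eta>\<close> up to a constant, so its
  minimiser is a projection. The obtuse angle at the projected point gives more than minimality: a
  gap quadratic in the distance to \<open>z\<close>.\<close>

lemma closest_point_minimises:
  fixes X :: "'a::euclidean_space set" and v :: 'a
  assumes "closed X" "convex X" "0 < \<eta>" "y \<in> X"
  defines "z \<equiv> closest_point X (- (\<eta> / 2) *\<^sub>R v)"
  shows "z \<bullet> v + (norm z)\<^sup>2 / \<eta> + (norm (y - z))\<^sup>2 / \<eta> \<le> y \<bullet> v + (norm y)\<^sup>2 / \<eta>"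
proof -
  have "(- (\<eta> / 2) *\<^sub>R v - z) \<bullet> (y - z) \<le> 0"
    unfolding z_def using assms by (intro closest_point_dot)
  then have "0 \<le> \<eta> * (v \<bullet> (y - z)) + 2 * (z \<bullet> (y - z))"
    by (simp add: inner_diff_left)
  moreover have "(norm y)\<^sup>2 = (norm z)\<^sup>2 + (norm (y - z))\<^sup>2 + 2 * (z \<bullet> (y - z))"
    by (simp add: power2_norm_eq_inner inner_diff_left inner_diff_right inner_commute)
  ultimately have "\<eta> * (z \<bullet> v) + (norm z)\<^sup>2 + (norm (y - z))\<^sup>2 \<le> \<eta> * (y \<bullet> v) + (norm y)\<^sup>2"
    by (simp add: inner_diff_right inner_commute algebra_simps)
  from divide_right_mono[OF this, of \<eta>] show ?thesis
    using \<open>0 < \<eta>\<close> by (simp add: add_divide_distrib)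
qed

text \<open>Its increment in round \<open>t\<close> is exactly the stability cost of that round in
  the regret analysis, so these costs telescope.\<close>

definition step_denom :: "real \<Rightarrow> real \<Rightarrow> (nat \<Rightarrow> 'a::euclidean_space) \<Rightarrow> nat \<Rightarrow> real" where
  "step_denom d \<nu> g t = \<nu> + (\<Sum>s\<in>{1..<t}. step_size d \<nu> g s * (norm (g s - prediction g s))\<^sup>2)"

lemma step_size_eq: "step_size d \<nu> g t = d\<^sup>2 / step_denom d \<nu> g t"
  by (subst step_size.simps) (simp add: step_denom_def)

lemma step_size_nonneg:
  assumes "0 < \<nu>"
  shows "0 \<le> step_size d \<nu> g t"
proof (induction t rule: less_induct)
  case (less t)
  then have "0 \<le> (\<Sum>s\<in>{1..<t}. step_size d \<nu> g s * (norm (g s - prediction g s))\<^sup>2)"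
    by (intro sum_nonneg) auto
  then show ?case
    using assms by (subst step_size.simps) auto
qed

lemma step_denom_ge:
  assumes "0 < \<nu>"
  shows "\<nu> \<le> step_denom d \<nu> g t"
  unfolding step_denom_def using step_size_nonneg[OF assms]
  by (auto intro!: sum_nonneg mult_nonneg_nonneg)

lemma step_denom_1 [simp]: "step_denom d \<nu> g (Suc 0) = \<nu>"
  by (simp add: step_denom_def)

lemma step_denom_Suc:
  assumes "1 \<le> t"
  shows "step_denom d \<nu> g (Suc t) =
    step_denom d \<nu> g t + step_size d \<nu> g t * (norm (g t - prediction g t))\<^sup>2"
  using assms by (simp add: step_denom_def sum.atLeastLessThan_Suc)

lemma step_denom_mono:
  assumes "0 < \<nu>" "1 \<le> s" "s \<le> t"
  shows "step_denom d \<nu> g s \<le> step_denom d \<nu> g t"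
  using assms(3)
proof (induction rule: dec_induct)
  case (step n)
  then show ?case
    using step_denom_Suc[of n d \<nu> g] step_size_nonneg[OF assms(1), of d g n] assms(2)
    by (simp add: add_increasing2)
qed simp

lemma step_size_pos:
  assumes "0 < \<nu>" "0 < d"
  shows "0 < step_size d \<nu> g t"
  using assms step_denom_ge[OF assms(1), of d g t] by (simp add: step_size_eq)

lemma inverse_step_size:
  assumes "0 < d"
  shows "a / step_size d \<nu> g t = a * step_denom d \<nu> g t / d\<^sup>2"
  using assms by (simp add: step_size_eq)

text \<open>
  Squaring the recursion \<open>S\<^sub>t\<^sub>+\<^sub>1 = S\<^sub>t + d\<^sup>2 a\<^sub>t / S\<^sub>t\<close> gives
  \<open>S\<^sub>t\<^sub>+\<^sub>1\<^sup>2 \<le> S\<^sub>t\<^sup>2 + 2 d\<^sup>2 a\<^sub>t + k (S\<^sub>t\<^sub>+\<^sub>1 - S\<^sub>t)\<close> as soon as all increments are at most \<open>k\<close>.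
\<close>

lemma step_denom_le_sqrt:
  assumes "0 < \<nu>" and b0: "0 \<le> b"
    and bd: "\<And>t. t \<in> {1..n} \<Longrightarrow> (norm (g t - prediction g t))\<^sup>2 \<le> b"
  shows "step_denom d \<nu> g (Suc n) \<le>
    \<nu> + d\<^sup>2 * b / \<nu> + sqrt 2 * \<bar>d\<bar> * sqrt (\<Sum>t\<in>{1..n}. (norm (g t - prediction g t))\<^sup>2)"
proof -
  define a where "a t = (norm (g t - prediction g t))\<^sup>2" for t
  define S where "S = step_denom d \<nu> g"
  define k where "k = d\<^sup>2 * b / \<nu>"
  have a0: "0 \<le> a t" for t
    by (simp add: a_def)
  have k0: "0 \<le> k"
    using b0 \<open>0 < \<nu>\<close> by (simp add: k_def)
  have S\<nu>: "\<nu> \<le> S t" for t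
    unfolding S_def by (rule step_denom_ge[OF \<open>0 < \<nu>\<close>])
  have rec: "S (Suc t) = S t + d\<^sup>2 * a t / S t" if "1 \<le> t" for t
    using step_denom_Suc[OF that, of d \<nu> g] by (simp add: S_def a_def step_size_eq)
  have "(S (Suc m))\<^sup>2 \<le> \<nu>\<^sup>2 + 2 * d\<^sup>2 * (\<Sum>t\<in>{1..m}. a t) + k * (S (Suc m) - \<nu>)" if "m \<le> n" for m
    using that
  proof (induction m)
    case 0
    then show ?case by (simp add: S_def)
  next
    case (Suc m)
    define e where "e = d\<^sup>2 * a (Suc m) / S (Suc m)"
    have pos: "0 < S (Suc m)"
      using S\<nu>[of "Suc m"] \<open>0 < \<nu>\<close> by simp
    have e0: "0 \<le> e"
      using a0 pos by (simp add: e_def)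
    have "a (Suc m) \<le> b"
      using bd[of "Suc m"] Suc.prems by (simp add: a_def)
    then have "e \<le> k"
      unfolding e_def k_def using S\<nu>[of "Suc m"] \<open>0 < \<nu>\<close> b0 a0
      by (intro frac_le mult_left_mono) auto
    then have "e\<^sup>2 \<le> k * e"
      using e0 by (simp add: power2_eq_square mult_right_mono)
    moreover have "S (Suc m) * e = d\<^sup>2 * a (Suc m)"
      using pos by (simp add: e_def)
    moreover have R: "S (Suc (Suc m)) = S (Suc m) + e"
      using rec[of "Suc m"] by (simp add: e_def)
    ultimately show ?case
      using Suc by (simp add: R power2_sum algebra_simps)
  qed
  from this[of n]
  have sq: "(S (Suc n))\<^sup>2 \<le> \<nu>\<^sup>2 + 2 * d\<^sup>2 * (\<Sum>t\<in>{1..n}. a t) + k * (S (Suc n) - \<nu>)" by simp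
  define q where "q = sqrt 2 * \<bar>d\<bar> * sqrt (\<Sum>t\<in>{1..n}. a t)"
  have q2: "q\<^sup>2 = 2 * d\<^sup>2 * (\<Sum>t\<in>{1..n}. a t)"
    using a0 by (simp add: q_def power_mult_distrib sum_nonneg)
  have q0: "0 \<le> q"
    using a0 by (simp add: q_def sum_nonneg)
  \<comment> \<open>A larger value would violate \<open>sq\<close>: multiply the strict inequality
    by \<open>S (Suc n)\<close>, which exceeds both \<open>\<nu>\<close> and
    \<open>q\<close>.\<close>
  have "S (Suc n) \<le> \<nu> + k + q"
  proof (rule ccontr)
    assume c: "\<not> S (Suc n) \<le> \<nu> + k + q"
    then have "S (Suc n) * (\<nu> + k + q) < S (Suc n) * S (Suc n)"
      using S\<nu>[of "Suc n"] \<open>0 < \<nu>\<close> by (intro mult_strict_left_mono) auto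
    moreover have "\<nu> * \<nu> \<le> S (Suc n) * \<nu>"
      using S\<nu>[of "Suc n"] \<open>0 < \<nu>\<close> by (intro mult_right_mono) auto
    moreover have "q * q \<le> S (Suc n) * q"
      using c q0 k0 \<open>0 < \<nu>\<close> by (intro mult_right_mono) auto
    moreover have "0 \<le> k * \<nu>"
      using k0 \<open>0 < \<nu>\<close> by simp
    ultimately show False
      using sq unfolding q2[symmetric] by (simp add: power2_eq_square algebra_simps)
  qed
  then show ?thesis
    unfolding S_def k_def q_def a_def .
qed

section \<open>Pathwise regret of optimistic FTRL\<close>

definition gradient_sum :: "(nat \<Rightarrow> 'a::euclidean_space) \<Rightarrow> nat \<Rightarrow> 'a" where
  "gradient_sum g t = (\<Sum>s\<in>{1..<t}. g s)"

lemma gradient_sum_Suc: "1 \<le> t \<Longrightarrow> gradient_sum g (Suc t) = gradient_sum g t + g t"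
  by (simp add: gradient_sum_def sum.atLeastLessThan_Suc)

lemma oftrl_in_set: "adaptive_oftrl X \<nu> T g x \<Longrightarrow> t \<in> {1..T} \<Longrightarrow> x t \<in> X"
  by (auto simp: adaptive_oftrl_def is_arg_min_def)

text \<open>Minimality of \<open>x t\<close> forces the quadratic gap of
  \<open>closest_point_minimises\<close> to vanish. The closed form later yields both the quadratic
  gain at \<open>x t\<close> and its measurability. If the diameter is 0, both sides are the only
  point of \<open>X\<close>.\<close>

lemma oftrl_eq_closest_point:
  fixes X :: "'a::euclidean_space set"
  assumes "closed X" "bounded X" "convex X" "0 < \<nu>" "adaptive_oftrl X \<nu> T g x" "t \<in> {1..T}"
  shows "x t = closest_point X
    (- (step_size (diameter X) \<nu> g t / 2) *\<^sub>R (prediction g t + gradient_sum g t))" (is "_ = ?z")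
proof -
  have xX: "x t \<in> X"
    using assms oftrl_in_set by blast
  then have zX: "?z \<in> X"
    using assms by (intro closest_point_in_set) auto
  have "0 \<le> diameter X"
    using assms by (simp add: diameter_ge_0)
  then consider "0 < diameter X" | "diameter X = 0" by linarith
  then show ?thesis
  proof cases
    case 1
    let ?\<eta> = "step_size (diameter X) \<nu> g t"
    let ?f = "\<lambda>y. y \<bullet> (prediction g t + gradient_sum g t) + (norm y)\<^sup>2 / ?\<eta>"
    have \<eta>: "0 < ?\<eta>"
      using 1 assms step_size_pos by blast
    have "?f ?z + (norm (x t - ?z))\<^sup>2 / ?\<eta> \<le> ?f (x t)"
      using closest_point_minimises[OF assms(1,3) \<eta> xX] by simp
    moreover have "?f (x t) \<le> ?f ?z"
      using assms(5,6) zX by (auto simp: adaptive_oftrl_def is_arg_min_def gradient_sum_def not_less)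
    ultimately have "(norm (x t - ?z))\<^sup>2 / ?\<eta> \<le> 0" by linarith
    then show ?thesis
      using \<eta> by (simp add: divide_le_0_iff)
  next
    case 2
    then have "dist (x t) ?z \<le> 0"
      using diameter_bounded_bound[OF assms(2) xX zX] by simp
    then show ?thesis by simp
  qed
qed

text \<open>
  Induction over the minimal values of the non-optimistic objectives, with minimisers \<open>z t\<close>.
  Optimality of \<open>z t\<close> against \<open>x t\<close>, and of \<open>x t\<close> against \<open>z (Suc t)\<close>, leaves two quadratic gains
  per round, which control the path length of \<open>x\<close>.
\<close>

lemma oftrl_regret:
  fixes X :: "'a::euclidean_space set"
  assumes X: "closed X" "bounded X" "convex X" "0 < diameter X" and \<nu>: "0 < \<nu>" and T: "1 \<le> T"
    and oftrl: "adaptive_oftrl X \<nu> T g x" and u: "u \<in> X"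
  defines "S \<equiv> step_denom (diameter X) \<nu> g"
  shows "regret T g x u \<le> ((norm u)\<^sup>2 / (diameter X)\<^sup>2 + 1) * S (Suc T)
    - \<nu> / (4 * (diameter X)\<^sup>2) * (\<Sum>t\<in>{2..T}. (norm (x t - x (t - 1)))\<^sup>2)"
proof -
  define d where "d = diameter X"
  define \<eta> where "\<eta> = step_size d \<nu> g"
  \<comment> \<open>This is the inverse of the first step size and bounds all later inverse step
    sizes from below.\<close>
  define k where "k = \<nu> / d\<^sup>2"
  define z where "z t = closest_point X (- (\<eta> t / 2) *\<^sub>R gradient_sum g t)" for t
  define \<Phi> where "\<Phi> t y = y \<bullet> gradient_sum g t + (norm y)\<^sup>2 / \<eta> t" for t y
  have S: "S t = step_denom d \<nu> g t" for t
    by (simp add: S_def d_def)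
  have d: "0 < d"
    using X by (simp add: d_def)
  have k: "0 < k"
    using d \<nu> by (simp add: k_def)
  have \<eta>: "0 < \<eta> t" for t
    using step_size_pos[OF \<nu> d] by (simp add: \<eta>_def)
  have div_\<eta>: "a / \<eta> t = a * S t / d\<^sup>2" for a t
    using inverse_step_size[OF d] by (simp add: \<eta>_def S)
  have k_le: "k * a \<le> a / \<eta> t" if "0 \<le> a" for a t
  proof -
    have "\<nu> * a \<le> S t * a"
      using step_denom_ge[OF \<nu>] that by (intro mult_right_mono) (auto simp: S)
    then show ?thesis
      using d by (simp add: div_\<eta> k_def divide_right_mono mult.commute)
  qed
  have zX: "z t \<in> X" for t
    unfolding z_def using X u by (intro closest_point_in_set) auto
  have z_min: "\<Phi> t (z t) + (norm (y - z t))\<^sup>2 / \<eta> t \<le> \<Phi> t y" if "y \<in> X" for t y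
    using closest_point_minimises[OF X(1,3) \<eta> that, of t "gradient_sum g t"] by (simp add: \<Phi>_def z_def)
  have step: "g t \<bullet> x t + \<Phi> t (z t) + k * (norm (x t - z t))\<^sup>2 + k / 2 * (norm (z (Suc t) - x t))\<^sup>2
      \<le> \<Phi> (Suc t) (z (Suc t)) + \<eta> t * (norm (g t - prediction g t))\<^sup>2" if t: "t \<in> {1..T}" for t
  proof -
    let ?m = "prediction g t" and ?z = "z (Suc t)"
    have xX: "x t \<in> X"
      using oftrl oftrl_in_set t by blast
    have x_min: "x t \<bullet> (?m + gradient_sum g t) + (norm (x t))\<^sup>2 / \<eta> t + (norm (?z - x t))\<^sup>2 / \<eta> t
        \<le> ?z \<bullet> (?m + gradient_sum g t) + (norm ?z)\<^sup>2 / \<eta> t"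
      using closest_point_minimises[OF X(1,3) \<eta> zX, of t "?m + gradient_sum g t" "Suc t"]
        oftrl_eq_closest_point[OF X(1-3) \<nu> oftrl t] by (simp add: \<eta>_def d_def)
    \<comment> \<open>Step sizes do not increase from round 1 on, so passing to the regulariser of
      the next round only raises the value.\<close>
    have mono: "(norm ?z)\<^sup>2 / \<eta> t \<le> (norm ?z)\<^sup>2 / \<eta> (Suc t)"
      using step_denom_mono[OF \<nu>, of t "Suc t" d g] t d
      by (simp add: div_\<eta> S divide_right_mono mult_left_mono)
    \<comment> \<open>Only half of the quadratic gain of \<open>x t\<close> is spent here; the other
      half is kept for the path length. The coefficient of the first term is 1 so that it equals the
      increment of \<open>S\<close>.\<close>
    have young: "(g t - ?m) \<bullet> (x t - ?z) \<le> \<eta> t * (norm (g t - ?m))\<^sup>2 + (norm (?z - x t))\<^sup>2 / (2 * \<eta> t)"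
    proof -
      define p q where "p = norm (g t - ?m)" and "q = norm (?z - x t)"
      have "(g t - ?m) \<bullet> (x t - ?z) \<le> p * q"
        using norm_cauchy_schwarz[of "g t - ?m" "x t - ?z"] by (simp add: p_def q_def norm_minus_commute)
      also have "p * q \<le> \<eta> t * p\<^sup>2 + q\<^sup>2 / (2 * \<eta> t)"
      proof -
        have "0 \<le> (\<eta> t * p - q)\<^sup>2 + (\<eta> t * p)\<^sup>2" by simp
        then have "2 * \<eta> t * (p * q) \<le> 2 * \<eta> t * (\<eta> t * p\<^sup>2) + q\<^sup>2"
          by (simp add: power2_diff power_mult_distrib power2_eq_square algebra_simps)
        then show ?thesis
          using \<eta>[of t] by (simp add: field_simps)
      qed
      finally show ?thesis by (simp add: p_def q_def)
    qed
    have half: "(norm (?z - x t))\<^sup>2 / (2 * \<eta> t) = (norm (?z - x t))\<^sup>2 / \<eta> t / 2"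
      by simp
    have "\<Phi> (Suc t) ?z = ?z \<bullet> gradient_sum g t + ?z \<bullet> g t + (norm ?z)\<^sup>2 / \<eta> (Suc t)"
      using t by (simp add: \<Phi>_def gradient_sum_Suc inner_add_right)
    moreover have "\<Phi> t (x t) = x t \<bullet> gradient_sum g t + (norm (x t))\<^sup>2 / \<eta> t"
      by (simp add: \<Phi>_def)
    ultimately show ?thesis
      using z_min[OF xX, of t] x_min mono young k_le[of "(norm (x t - z t))\<^sup>2" t]
        k_le[of "(norm (?z - x t))\<^sup>2" t] unfolding half
      by (simp add: inner_add_right inner_diff_left inner_diff_right inner_commute)
  qed
  \<comment> \<open>Used with \<open>c = z (Suc n)\<close> between \<open>b = x n\<close> and
    \<open>a = x (Suc n)\<close>: the gain left by one round and the gain of the next meet at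
    \<open>c\<close> and together pay for one path term.\<close>
  have tri: "k / 4 * (norm (a - b))\<^sup>2 \<le> k * (norm (a - c))\<^sup>2 + k / 2 * (norm (c - b))\<^sup>2" for a b c :: 'a
  proof -
    have "norm (a - b) \<le> norm (a - c) + norm (c - b)"
      using norm_triangle_ineq[of "a - c" "c - b"] by simp
    then have "(norm (a - b))\<^sup>2 \<le> (norm (a - c) + norm (c - b))\<^sup>2"
      by (intro power_mono) auto
    also have "\<dots> \<le> 2 * (norm (a - c))\<^sup>2 + 2 * (norm (c - b))\<^sup>2"
      using zero_le_power2[of "norm (a - c) - norm (c - b)"] by (simp add: power2_sum power2_diff)
    also have "\<dots> \<le> 4 * (norm (a - c))\<^sup>2 + 2 * (norm (c - b))\<^sup>2" by simp
    finally have "k / 4 * (norm (a - b))\<^sup>2 \<le> k / 4 * (4 * (norm (a - c))\<^sup>2 + 2 * (norm (c - b))\<^sup>2)"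
      using k by (intro mult_left_mono) auto
    then show ?thesis by (simp add: algebra_simps)
  qed
  \<comment> \<open>The gain between \<open>x n\<close> and \<open>z (Suc n)\<close> stays in the
    invariant, since the path term of the next round consumes it.\<close>
  have "(\<Sum>t\<in>{1..n}. g t \<bullet> x t) + k / 4 * (\<Sum>t\<in>{2..n}. (norm (x t - x (t - 1)))\<^sup>2)
      + k / 2 * (norm (z (Suc n) - x n))\<^sup>2
      \<le> \<Phi> (Suc n) (z (Suc n)) + (S (Suc n) - \<nu>)" if "1 \<le> n" "n \<le> T" for n
    using that
  proof (induction n rule: nat_induct_at_least)
    case base
    have "0 \<le> \<Phi> 1 (z 1) + k * (norm (x 1 - z 1))\<^sup>2"
      using \<eta>[of 1] k by (simp add: \<Phi>_def gradient_sum_def)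
    then show ?case
      using step[of 1] base step_denom_Suc[of 1 d \<nu> g] by (simp add: S \<eta>_def)
  next
    case (Suc n)
    have "S (Suc (Suc n)) = S (Suc n) + \<eta> (Suc n) * (norm (g (Suc n) - prediction g (Suc n)))\<^sup>2"
      using step_denom_Suc[of "Suc n" d \<nu> g] by (simp add: S \<eta>_def)
    moreover have "(\<Sum>t\<in>{2..Suc n}. (norm (x t - x (t - 1)))\<^sup>2)
        = (\<Sum>t\<in>{2..n}. (norm (x t - x (t - 1)))\<^sup>2) + (norm (x (Suc n) - x n))\<^sup>2"
      using Suc.hyps by simp
    ultimately show ?case
      using Suc step[of "Suc n"] tri[of "x (Suc n)" "x n" "z (Suc n)"] by (simp add: distrib_left)
  qed
  from this[OF T order_refl]
  have "(\<Sum>t\<in>{1..T}. g t \<bullet> x t) + k / 4 * (\<Sum>t\<in>{2..T}. (norm (x t - x (t - 1)))\<^sup>2)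
      \<le> \<Phi> (Suc T) (z (Suc T)) + (S (Suc T) - \<nu>)"
    using k by (smt (verit) divide_nonneg_nonneg mult_nonneg_nonneg zero_le_power2)
  also have "\<Phi> (Suc T) (z (Suc T)) \<le> \<Phi> (Suc T) u"
    using z_min[OF u, of "Suc T"] \<eta>[of "Suc T"]
    by (smt (verit) divide_nonneg_pos zero_le_power2)
  also have "\<Phi> (Suc T) u = (\<Sum>t\<in>{1..T}. g t \<bullet> u) + (norm u)\<^sup>2 / d\<^sup>2 * S (Suc T)"
    by (simp add: \<Phi>_def gradient_sum_def div_\<eta> inner_sum_right inner_commute atLeastLessThanSuc_atLeastAtMost)
  finally show ?thesis
    using \<nu> by (simp add: regret_def inner_diff_right sum_subtractf k_def d_def algebra_simps)
qed

lemma sum4_squared_le: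
  fixes a b c d e :: real
  assumes "0 \<le> a" "a \<le> b + c + d + e"
  shows "a\<^sup>2 \<le> 4 * (b\<^sup>2 + c\<^sup>2 + d\<^sup>2 + e\<^sup>2)"
proof -
  have "a\<^sup>2 \<le> (b + c + d + e)\<^sup>2"
    using assms by (intro power_mono)
  also have "\<dots> \<le> 4 * (b\<^sup>2 + c\<^sup>2 + d\<^sup>2 + e\<^sup>2)"
    using zero_le_power2[of "b - c"] zero_le_power2[of "b - d"] zero_le_power2[of "b - e"]
      zero_le_power2[of "c - d"] zero_le_power2[of "c - e"] zero_le_power2[of "d - e"]
    by (simp add: power2_eq_square algebra_simps)
  finally show ?thesis .
qed

text \<open>
  The path length of \<open>x\<close> enters the step sizes through smoothness; by \<open>b q - a q\<^sup>2 \<le> b\<^sup>2 / (4 a)\<close> its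
  contribution is absorbed by the negative term of the regret bound above.
\<close>

lemma oftrl_regret_le_noise:
  fixes X :: "'a::euclidean_space set"
  assumes X: "closed X" "bounded X" "convex X" "0 < diameter X" and \<nu>: "0 < \<nu>" and T: "1 \<le> T"
    and oftrl: "adaptive_oftrl X \<nu> T g x" and u: "u \<in> X" "norm u \<le> r"
    and G: "0 \<le> G" "\<And>t. t \<in> {1..T} \<Longrightarrow> norm (g t) \<le> G"
    and L: "0 \<le> L" and C: "0 \<le> C"
    and diff: "\<And>t. t \<in> {2..T} \<Longrightarrow>
      norm (g t - g (t - 1)) \<le> n t + n (t - 1) + L * norm (x t - x (t - 1)) + e t"
    and e: "(\<Sum>t\<in>{2..T}. (e t)\<^sup>2) \<le> 4 * G * C"
  defines "d \<equiv> diameter X" and "k \<equiv> (r / diameter X)\<^sup>2 + 1"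
  shows "regret T g x u \<le> 8 * k * d * (sqrt (\<Sum>t\<in>{1..T}. (n t)\<^sup>2) + sqrt (G * C))
    + (k * (\<nu> + 4 * d\<^sup>2 * G\<^sup>2 / \<nu> + 2 * d * G) + 16 * k\<^sup>2 * d ^ 4 * L\<^sup>2 / \<nu>)"
proof -
  define N where "N = (\<Sum>t\<in>{1..T}. (n t)\<^sup>2)"
  define q where "q = sqrt (\<Sum>t\<in>{2..T}. (norm (x t - x (t - 1)))\<^sup>2)"
  define A where "A = (\<Sum>t\<in>{1..T}. (norm (g t - prediction g t))\<^sup>2)"
  have d: "0 < d"
    using X by (simp add: d_def)
  have q: "0 \<le> q" "q\<^sup>2 = (\<Sum>t\<in>{2..T}. (norm (x t - x (t - 1)))\<^sup>2)"
    by (simp_all add: q_def sum_nonneg)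
  have N: "0 \<le> N"
    by (simp add: N_def sum_nonneg)
  have "norm (g t - prediction g t) \<le> 2 * G" if "t \<in> {1..T}" for t
  proof (cases "t = 1")
    case True
    then show ?thesis
      using G(2)[OF that] G(1) by (simp add: prediction_def)
  next
    case False
    then have "t - 1 \<in> {1..T}"
      using that by auto
    then show ?thesis
      using False that G(2)[of t] G(2)[of "t - 1"] norm_triangle_ineq4[of "g t" "g (t - 1)"]
      by (auto simp: prediction_def)
  qed
  then have bd: "(norm (g t - prediction g t))\<^sup>2 \<le> 4 * G\<^sup>2" if "t \<in> {1..T}" for t
    using that power_mono[of "norm (g t - prediction g t)" "2 * G" 2] by (simp add: power_mult_distrib)
  have "A = (norm (g 1))\<^sup>2 + (\<Sum>t\<in>{2..T}. (norm (g t - g (t - 1)))\<^sup>2)"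
  proof -
    have "(\<Sum>t\<in>{2..T}. (norm (g t - prediction g t))\<^sup>2) = (\<Sum>t\<in>{2..T}. (norm (g t - g (t - 1)))\<^sup>2)"
      by (intro sum.cong) (auto simp: prediction_def)
    then show ?thesis
      using sum.atLeast_Suc_atMost[OF T, of "\<lambda>t. (norm (g t - prediction g t))\<^sup>2"]
      by (simp add: A_def prediction_def numeral_2_eq_2)
  qed
  also have "\<dots> \<le> G\<^sup>2 + (\<Sum>t\<in>{2..T}. 4 * ((n t)\<^sup>2 + (n (t - 1))\<^sup>2 + (L * norm (x t - x (t - 1)))\<^sup>2 + (e t)\<^sup>2))"
    using diff G(2)[of 1] T by (intro add_mono sum_mono sum4_squared_le power_mono) auto
  also have "\<dots> = G\<^sup>2 + 4 * ((\<Sum>t\<in>{2..T}. (n t)\<^sup>2) + (\<Sum>t\<in>{2..T}. (n (t - 1))\<^sup>2) + L\<^sup>2 * q\<^sup>2 + (\<Sum>t\<in>{2..T}. (e t)\<^sup>2))"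
    unfolding q(2) by (simp add: sum.distrib sum_distrib_left power_mult_distrib)
  \<comment> \<open>The noise of a round enters at most two consecutive gradient differences, hence
    \<open>N\<close> twice.\<close>
  also have "\<dots> \<le> G\<^sup>2 + 4 * (N + N + L\<^sup>2 * q\<^sup>2 + 4 * G * C)"
  proof -
    have "(\<Sum>t\<in>{2..T}. (n t)\<^sup>2) \<le> N"
      unfolding N_def by (intro sum_mono2) auto
    moreover have "(\<Sum>t\<in>{2..T}. (n (t - 1))\<^sup>2) \<le> N"
    proof -
      have "(\<Sum>t\<in>{2..T}. (n (t - 1))\<^sup>2) = (\<Sum>t\<in>(\<lambda>t. t - 1) ` {2..T}. (n t)\<^sup>2)"
        by (subst sum.reindex) (auto simp: inj_on_def)
      also have "\<dots> \<le> N"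
        unfolding N_def by (intro sum_mono2) auto
      finally show ?thesis .
    qed
    ultimately show ?thesis
      using e by simp
  qed
  \<comment> \<open>The factor 3 comes from \<open>8 * N \<le> (3 * sqrt N)\<^sup>2\<close>; the
    other squares match exactly and all cross terms are nonnegative.\<close>
  also have "\<dots> \<le> (G + 3 * sqrt N + 2 * L * q + 4 * sqrt (G * C))\<^sup>2"
  proof -
    define m p where "m = sqrt N" and "p = sqrt (G * C)"
    have mp: "0 \<le> m" "0 \<le> p" "m\<^sup>2 = N" "p\<^sup>2 = G * C"
      using N G C by (simp_all add: m_def p_def)
    have "0 \<le> m\<^sup>2 + 6 * (G * m) + 4 * (G * (L * q)) + 8 * (G * p) + 12 * (m * (L * q))
        + 24 * (m * p) + 16 * ((L * q) * p)"
      using G(1) L q(1) mp(1,2) by (intro add_nonneg_nonneg) simp_all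
    then have "G\<^sup>2 + 4 * (m\<^sup>2 + m\<^sup>2 + L\<^sup>2 * q\<^sup>2 + 4 * p\<^sup>2) \<le> (G + 3 * m + 2 * L * q + 4 * p)\<^sup>2"
      by (simp add: power2_eq_square algebra_simps)
    then show ?thesis
      unfolding mp by (simp add: m_def p_def mult.assoc)
  qed
  finally have "A \<le> (G + 3 * sqrt N + 2 * L * q + 4 * sqrt (G * C))\<^sup>2" .
  then have sqrt_A: "sqrt A \<le> G + 3 * sqrt N + 2 * L * q + 4 * sqrt (G * C)"
    using G L q N C by (intro real_le_lsqrt) (auto intro!: add_nonneg_nonneg)
  have "sqrt 2 * d * sqrt A \<le> 2 * d * sqrt A"
    using d A_def by (intro mult_right_mono) (auto simp: sqrt2_less_2 less_imp_le sum_nonneg)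
  also have "\<dots> \<le> 2 * d * (G + 3 * sqrt N + 2 * L * q + 4 * sqrt (G * C))"
    using d sqrt_A by (intro mult_left_mono) auto
  also have "\<dots> \<le> 2 * d * G + 8 * d * (sqrt N + sqrt (G * C)) + 4 * d * L * q"
    using d N by (simp add: algebra_simps)
  finally have S: "step_denom d \<nu> g (Suc T) \<le>
      \<nu> + 4 * d\<^sup>2 * G\<^sup>2 / \<nu> + 2 * d * G + 8 * d * (sqrt N + sqrt (G * C)) + 4 * d * L * q"
    using step_denom_le_sqrt[OF \<nu> _ bd, of T d] d by (simp add: A_def mult.assoc mult.left_commute)
  have S0: "0 \<le> step_denom d \<nu> g (Suc T)"
    using step_denom_ge[OF \<nu>, of d g "Suc T"] \<nu> by simp
  \<comment> \<open>The inequality \<open>b * q - a * q\<^sup>2 \<le> b\<^sup>2 / (4 * a)\<close>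
    with \<open>a = \<nu> / (4 * d\<^sup>2)\<close> and \<open>b = 4 * k * d * L\<close>.\<close>
  have absorb: "4 * k * d * L * q - \<nu> / (4 * d\<^sup>2) * q\<^sup>2 \<le> 16 * k\<^sup>2 * d ^ 4 * L\<^sup>2 / \<nu>"
  proof -
    have "0 \<le> (\<nu> * q - 8 * k * d ^ 3 * L)\<^sup>2 / (4 * d\<^sup>2 * \<nu>)"
      using \<nu> by simp
    also have "\<dots> = \<nu> / (4 * d\<^sup>2) * q\<^sup>2 - 4 * k * d * L * q + 16 * k\<^sup>2 * d ^ 4 * L\<^sup>2 / \<nu>"
      using \<nu> d by (simp add: field_simps power2_eq_square eval_nat_numeral)
    finally show ?thesis by simp
  qed
  have k: "0 \<le> k"
    by (simp add: k_def)
  have "(norm u)\<^sup>2 / d\<^sup>2 + 1 \<le> k"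
    unfolding k_def d_def power_divide using u by (intro add_mono divide_right_mono power_mono) auto
  then have "((norm u)\<^sup>2 / d\<^sup>2 + 1) * step_denom d \<nu> g (Suc T) \<le> k * step_denom d \<nu> g (Suc T)"
    using S0 by (rule mult_right_mono)
  also have "\<dots> \<le> k * (\<nu> + 4 * d\<^sup>2 * G\<^sup>2 / \<nu> + 2 * d * G + 8 * d * (sqrt N + sqrt (G * C)) + 4 * d * L * q)"
    using S k by (rule mult_left_mono)
  finally have "regret T g x u \<le>
      k * (\<nu> + 4 * d\<^sup>2 * G\<^sup>2 / \<nu> + 2 * d * G + 8 * d * (sqrt N + sqrt (G * C)) + 4 * d * L * q)
      - \<nu> / (4 * d\<^sup>2) * q\<^sup>2"
    using oftrl_regret[OF X \<nu> T oftrl u(1)] unfolding q(2) d_def by linarith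
  then show ?thesis
    using absorb by (simp add: N_def algebra_simps)
qed

section \<open>Two facts about probability spaces\<close>

lemma (in prob_space) AE_imp_ex:
  assumes "AE w in M. P w"
  shows "\<exists>w\<in>space M. P w"
proof (rule ccontr)
  assume "\<not> (\<exists>w\<in>space M. P w)"
  then have "AE w in M. False"
    using assms AE_space by (auto elim: eventually_elim2)
  then show False by simp
qed

text \<open>Jensen's inequality for the root, read off from the nonnegativity of the variance of
  \<open>sqrt (f w)\<close>; integrability follows from \<open>sqrt a \<le> 1 + a\<close>.\<close>

lemma (in prob_space) expectation_sqrt_le:
  assumes "integrable M f" "\<And>w. 0 \<le> f w"
  shows "integrable M (\<lambda>w. sqrt (f w))" and "expectation (\<lambda>w. sqrt (f w)) \<le> sqrt (expectation f)"
proof -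
  show int: "integrable M (\<lambda>w. sqrt (f w))"
  proof (rule Bochner_Integration.integrable_bound)
    show "integrable M (\<lambda>w. 1 + f w)"
      using assms by simp
    show "AE w in M. norm (sqrt (f w)) \<le> norm (1 + f w)"
    proof (rule AE_I2)
      fix w
      have "0 \<le> (sqrt (f w) - 1)\<^sup>2 + 1 + f w"
        using assms by simp
      then show "norm (sqrt (f w)) \<le> norm (1 + f w)"
        using assms(2)[of w] by (simp add: power2_diff)
    qed
  qed (use assms in measurable)
  have "(expectation (\<lambda>w. sqrt (f w)))\<^sup>2 \<le> expectation (\<lambda>w. (sqrt (f w))\<^sup>2)"
    using variance_eq[OF int] variance_positive[of "\<lambda>w. sqrt (f w)"] assms by simp
  then show "expectation (\<lambda>w. sqrt (f w)) \<le> sqrt (expectation f)"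
    using assms by (intro real_le_rsqrt) simp
qed

section \<open>Past, fresh sample and noise variance in the corrupted model\<close>

context corrupted_stochastic_model
begin

lemma measurable_Fil_mono: "f \<in> measurable (Fil s) N \<Longrightarrow> s \<le> t \<Longrightarrow> f \<in> measurable (Fil t) N"
  using sets_F_mono[of s t] by (auto simp: measurable_def space_F)

lemma measurable_Fil: "f \<in> measurable (Fil t) N \<Longrightarrow> f \<in> measurable M N"
  using measurable_from_subalg subalgebra_Fil by blast

lemma id_measurable_Fil: "(\<lambda>w. w) \<in> measurable M (Fil t)"
  by (rule measurable_Fil[OF measurable_ident_sets]) simp

text \<open>\<open>subalgebra\<close> compares sigma-algebras only, so \<open>Fil t\<close> may
  carry any measure of its own. The pushforward along the identity is the restriction of
  \<open>M\<close> to the events of \<open>Fil t\<close>.\<close>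

lemma prob_space_past: "prob_space (distr M (Fil t) (\<lambda>w. w))"
  by (intro prob_space_distr id_measurable_Fil)

lemma sample_measurable': "t \<in> {1..T} \<Longrightarrow> \<xi> t \<in> measurable M D"
  using sample_measurable measurable_Fil by blast

lemma past_pair_measurable:
  "t \<in> {1..T} \<Longrightarrow> (\<lambda>w. (w, \<xi> t w)) \<in> measurable M (Fil (t - 1) \<Otimes>\<^sub>M D)"
  by (intro measurable_Pair id_measurable_Fil sample_measurable')

text \<open>Independence gives the product formula on rectangles, which determines the joint law.
  Fubini then allows integrating over the fresh sample with the past frozen.\<close>

lemma distr_past_sample:
  assumes t: "t \<in> {1..T}"
  shows "distr M (Fil (t - 1) \<Otimes>\<^sub>M D) (\<lambda>w. (w, \<xi> t w)) = distr M (Fil (t - 1)) (\<lambda>w. w) \<Otimes>\<^sub>M D"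
proof -
  let ?P = "distr M (Fil (t - 1)) (\<lambda>w. w)"
  let ?Q = "distr M (Fil (t - 1) \<Otimes>\<^sub>M D) (\<lambda>w. (w, \<xi> t w))"
  have "?P \<Otimes>\<^sub>M D = ?Q"
  proof (rule pair_measure_eqI)
    show "sigma_finite_measure ?P"
      by (rule prob_space_imp_sigma_finite[OF prob_space_past])
    show "sigma_finite_measure D"
      by (rule source.sigma_finite_measure_axioms)
    show "sets (?P \<Otimes>\<^sub>M D) = sets ?Q"
      by (simp cong: sets_pair_measure_cong)
    fix A B assume "A \<in> sets ?P" and B: "B \<in> sets D"
    then have A: "A \<in> sets (Fil (t - 1))" by simp
    have A_sub: "A \<subseteq> space M"
      using sets.sets_into_space[OF A] by (simp add: space_F)
    let ?B = "\<xi> t -` B \<inter> space M"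
    have "?B \<in> sets (vimage_algebra (space M) (\<xi> t) D)"
      using B by (rule in_vimage_algebra)
    then have "prob (A \<inter> ?B) = prob A * prob ?B"
      using sample_indep[OF t] A unfolding indep_sets2_eq by blast
    then have "emeasure M (A \<inter> ?B) = emeasure M A * emeasure M ?B"
      by (simp add: emeasure_eq_measure ennreal_mult)
    moreover have "emeasure ?P A = emeasure M A"
      using A_sub by (subst emeasure_distr[OF id_measurable_Fil A]) (simp add: Int_absorb2)
    moreover have "emeasure D B = emeasure M ?B"
      using emeasure_distr[OF sample_measurable'[OF t] B] sample_distr[OF t] by simp
    moreover have "emeasure ?Q (A \<times> B) = emeasure M (A \<inter> ?B)"
      using A B A_sub by (subst emeasure_distr[OF past_pair_measurable[OF t]])
        (auto intro!: arg_cong[where f = "emeasure M"])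
    ultimately show "emeasure ?P A * emeasure D B = emeasure ?Q (A \<times> B)" by simp
  qed
  then show ?thesis ..
qed

lemma h'_measurable_compose:
  assumes "y \<in> measurable N (restrict_space borel X)" "s \<in> measurable N D"
  shows "(\<lambda>w. h' (y w) (s w)) \<in> borel_measurable N"
  using measurable_compose[OF measurable_Pair[OF assms] h'_measurable] by simp

lemma c'_measurable_compose:
  assumes "t \<in> {1..T}" "y \<in> measurable (Fil (t - 1)) (restrict_space borel X)"
  shows "(\<lambda>w. c' t w (y w)) \<in> borel_measurable (Fil (t - 1))"
  using measurable_compose[OF measurable_Pair[OF measurable_ident assms(2)] c'_measurable[OF assms(1)]]
  by (simp add: id_def)

text \<open>Under the product law of past and sample, an almost sure bound at the drawn sample
  becomes, by Fubini, a bound for almost every past and almost every sample. This decouples the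
  bound from \<open>\<xi> t\<close>, so that two rounds can be compared at one common
  sample.\<close>

lemma loss_gradient_bound_fresh:
  assumes t: "t \<in> {1..T}" and y: "y \<in> measurable (Fil (t - 1)) (restrict_space borel X)"
  shows "AE w in M. AE s in D. norm (h' (y w) s + c' t w (y w)) \<le> G"
proof -
  let ?P = "distr M (Fil (t - 1)) (\<lambda>w. w)"
  interpret P: prob_space ?P
    by (rule prob_space_past)
  interpret PD: pair_sigma_finite ?P D ..
  have yX: "y w \<in> X" if "w \<in> space M" for w
    using measurable_space[OF y, of w] that by (simp add: space_F space_restrict_space)
  have meas: "(\<lambda>p. h' (y (fst p)) (snd p) + c' t (fst p) (y (fst p))) \<in> borel_measurable (Fil (t - 1) \<Otimes>\<^sub>M D)"
    using h'_measurable_compose[OF measurable_compose[OF measurable_fst y] measurable_snd]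
      measurable_compose[OF measurable_fst c'_measurable_compose[OF t y]]
    by (intro borel_measurable_add) auto
  then have pred: "{p \<in> space (Fil (t - 1) \<Otimes>\<^sub>M D). norm (h' (y (fst p)) (snd p) + c' t (fst p) (y (fst p))) \<le> G}
      \<in> sets (Fil (t - 1) \<Otimes>\<^sub>M D)"
    by measurable
  have "AE w in M. norm (h' (y w) (\<xi> t w) + c' t w (y w)) \<le> G"
    using loss_gradient_bound[OF t] AE_space by eventually_elim (auto simp: corrupted_def yX)
  then have "AE p in distr M (Fil (t - 1) \<Otimes>\<^sub>M D) (\<lambda>w. (w, \<xi> t w)).
      norm (h' (y (fst p)) (snd p) + c' t (fst p) (y (fst p))) \<le> G"
    by (subst AE_distr_iff[OF past_pair_measurable[OF t] pred]) simp
  then have "AE p in ?P \<Otimes>\<^sub>M D. norm (h' (y (fst p)) (snd p) + c' t (fst p) (y (fst p))) \<le> G"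
    unfolding distr_past_sample[OF t] .
  from PD.AE_pair[OF this] have "AE w in ?P. AE s in D. norm (h' (y w) s + c' t w (y w)) \<le> G"
    by simp
  then show ?thesis
    by (rule AE_distrD[OF id_measurable_Fil])
qed

text \<open>For some outcome \<open>w\<close>, the sum of \<open>F'\<close> and the measurable field
  \<open>c' 1 w\<close> is Lipschitz, hence continuous; subtract the field.\<close>

lemma F'_measurable: "F' \<in> borel_measurable (restrict_space borel X)"
proof -
  have 1: "1 \<in> {1..T}"
    using horizon by simp
  have "\<exists>w\<in>space M. L-lipschitz_on X (\<lambda>y. F' y + c' 1 w y)"
    using AE_imp_ex[OF smooth[OF 1]] .
  then obtain w where w: "w \<in> space M" "L-lipschitz_on X (\<lambda>y. F' y + c' 1 w y)" by blast
  have "(\<lambda>y. F' y + c' 1 w y) \<in> borel_measurable (restrict_space borel X)"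
    using w(2) by (intro borel_measurable_continuous_on_restrict lipschitz_on_continuous_on)
  moreover have "(\<lambda>y. c' 1 w y) \<in> borel_measurable (restrict_space borel X)"
    using measurable_compose[OF measurable_Pair1' c'_measurable[OF 1]] w(1) by (simp add: space_F)
  ultimately have "(\<lambda>y. (F' y + c' 1 w y) - c' 1 w y) \<in> borel_measurable (restrict_space borel X)"
    by (rule borel_measurable_diff)
  then show ?thesis by simp
qed

lemma corruption_level_AE:
  "AE w in M. (\<forall>t\<in>{1..T}. \<forall>y\<in>X. norm (c' t w y) \<le> (SUP y\<in>X. norm (c' t w y))) \<and>
    (\<Sum>t\<in>{1..T}. SUP y\<in>X. norm (c' t w y)) \<le> C"
proof -
  have "AE w in M. \<forall>t\<in>{1..T}. bdd_above ((\<lambda>y. norm (c' t w y)) ` X)"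
    using corruption_bdd by (intro AE_finite_allI) auto
  then show ?thesis
    using corruption_level
  proof eventually_elim
    case (elim w)
    then show ?case by (auto intro!: cSUP_upper)
  qed
qed

text \<open>A real \<open>SUP\<close> dominates its members only over a bounded set. Here
  \<open>F'\<close> is bounded because a Lipschitz field on the bounded set \<open>X\<close> is,
  after removing a bounded corruption, and \<open>h' y\<close> is almost surely at most
  \<open>G + C\<close>, since one round's corruption is at most \<open>C\<close>.\<close>

lemma bdd_above_variance:
  assumes "bounded X"
  shows "bdd_above ((\<lambda>y. \<integral>s. (norm (h' y s - F' y))\<^sup>2 \<partial>D) ` X)"
proof -
  have 1: "1 \<in> {1..T}"
    using horizon by simp
  have "AE w in M. L-lipschitz_on X (\<lambda>y. F' y + c' 1 w y) \<and> bdd_above ((\<lambda>y. norm (c' 1 w y)) ` X)"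
    using smooth[OF 1] corruption_bdd[OF 1] by eventually_elim (rule conjI)
  from AE_imp_ex[OF this] obtain w where lip: "L-lipschitz_on X (\<lambda>y. F' y + c' 1 w y)"
    and bdd: "bdd_above ((\<lambda>y. norm (c' 1 w y)) ` X)"
    by blast
  have "bounded ((\<lambda>y. F' y + c' 1 w y) ` X)"
    using lipschitz_on_uniformly_continuous[OF lip] assms
    by (rule bounded_uniformly_continuous_image)
  then obtain b where b: "norm (F' y + c' 1 w y) \<le> b" if "y \<in> X" for y
    by (auto simp: bounded_iff)
  obtain b' where b': "norm (c' 1 w y) \<le> b'" if "y \<in> X" for y
    using bdd by (auto simp: bdd_above_def)
  have F': "norm (F' y) \<le> b + b'" if "y \<in> X" for y
    using b[OF that] b'[OF that] norm_triangle_ineq4[of "F' y + c' 1 w y" "c' 1 w y"] by simp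
  have h': "AE s in D. norm (h' y s) \<le> G + C" if y: "y \<in> X" for y
  proof -
    have "AE w in M. norm (h' y (\<xi> 1 w)) \<le> G + C"
      using loss_gradient_bound[OF 1] corruption_level_AE
    proof eventually_elim
      case (elim w)
      have m: "norm (c' t w y) \<le> (SUP y\<in>X. norm (c' t w y))" if "t \<in> {1..T}" for t
        using elim(2) y that by blast
      have "norm (c' 1 w y) \<le> (SUP y\<in>X. norm (c' 1 w y))"
        by (rule m[OF 1])
      also have "\<dots> \<le> (\<Sum>t\<in>{1..T}. SUP y\<in>X. norm (c' t w y))"
        using m 1 by (intro member_le_sum) (auto intro: order_trans[OF norm_ge_zero])
      finally have "norm (c' 1 w y) \<le> C"
        using elim by simp
      moreover have "norm (h' y (\<xi> 1 w) + c' 1 w y) \<le> G"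
        using elim y by (simp add: corrupted_def)
      ultimately show ?case
        using norm_triangle_ineq4[of "h' y (\<xi> 1 w) + c' 1 w y" "c' 1 w y"] by simp
    qed
    moreover have "{s \<in> space D. norm (h' y s) \<le> G + C} \<in> sets D"
      using h'_measurable_compose[of "\<lambda>_. y" D "\<lambda>s. s"] y by (simp add: space_restrict_space)
    ultimately have "AE s in distr M D (\<xi> 1). norm (h' y s) \<le> G + C"
      by (simp only: AE_distr_iff[OF sample_measurable'[OF 1]])
    then show ?thesis
      unfolding sample_distr[OF 1] .
  qed
  show ?thesis
  proof (rule bdd_aboveI2)
    fix y assume y: "y \<in> X"
    have "AE s in D. (norm (h' y s - F' y))\<^sup>2 \<le> (G + C + (b + b'))\<^sup>2"
      using h'[OF y]
    proof eventually_elim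
      case (elim s)
      then show ?case
        using F'[OF y] norm_triangle_ineq4[of "h' y s" "F' y"] by (intro power_mono) auto
    qed
    then show "(\<integral>s. (norm (h' y s - F' y))\<^sup>2 \<partial>D) \<le> (G + C + (b + b'))\<^sup>2"
      by (intro source.integral_le_const finite_variance[OF y])
  qed
qed

text \<open>Once the past is frozen, \<open>y w\<close> is a fixed point of \<open>X\<close>, so the
  inner integral over the fresh sample is at most the supremum \<open>v\<close>. The nonnegative
  integral is used so that integrability comes out as well.\<close>

lemma noise_variance:
  assumes "bounded X" and t: "t \<in> {1..T}" and y: "y \<in> measurable (Fil (t - 1)) (restrict_space borel X)"
  defines "n \<equiv> \<lambda>w. (norm (h' (y w) (\<xi> t w) - F' (y w)))\<^sup>2"
  shows "integrable M n" and "expectation n \<le> (gradient_sd D X h' F')\<^sup>2"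
proof -
  define v where "v = (SUP y\<in>X. \<integral>s. (norm (h' y s - F' y))\<^sup>2 \<partial>D)"
  let ?P = "distr M (Fil (t - 1)) (\<lambda>w. w)"
  interpret P: prob_space ?P
    by (rule prob_space_past)
  interpret PD: pair_sigma_finite ?P D ..
  have yX: "y w \<in> X" if "w \<in> space M" for w
    using measurable_space[OF y, of w] that by (simp add: space_F space_restrict_space)
  have le_v: "(\<integral>s. (norm (h' z s - F' z))\<^sup>2 \<partial>D) \<le> v" if "z \<in> X" for z
    unfolding v_def using bdd_above_variance[OF \<open>bounded X\<close>] that by (intro cSUP_upper)
  obtain w0 where "w0 \<in> space M"
    using not_empty by blast
  then have v0: "0 \<le> v"
    using order_trans[OF _ le_v[OF yX]] by simp
  then have sd: "(gradient_sd D X h' F')\<^sup>2 = v"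
    by (simp add: gradient_sd_def v_def)
  define f where "f p = ennreal ((norm (h' (y (fst p)) (snd p) - F' (y (fst p))))\<^sup>2)" for p
  have f: "f \<in> borel_measurable (Fil (t - 1) \<Otimes>\<^sub>M D)"
    unfolding f_def
    using h'_measurable_compose[OF measurable_compose[OF measurable_fst y] measurable_snd]
      measurable_compose[OF measurable_compose[OF measurable_fst y] F'_measurable]
    by measurable
  have y': "y \<in> measurable M (restrict_space borel X)"
    using measurable_Fil y by blast
  have n: "n \<in> borel_measurable M"
    unfolding n_def
    using h'_measurable_compose[OF y' sample_measurable'[OF t]] measurable_compose[OF y' F'_measurable]
    by measurable
  have "(\<integral>\<^sup>+w. ennreal (n w) \<partial>M) = (\<integral>\<^sup>+p. f p \<partial>distr M (Fil (t - 1) \<Otimes>\<^sub>M D) (\<lambda>w. (w, \<xi> t w)))"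
    using f by (subst nn_integral_distr[OF past_pair_measurable[OF t]]) (auto simp: f_def n_def)
  also have "\<dots> = (\<integral>\<^sup>+p. f p \<partial>(?P \<Otimes>\<^sub>M D))"
    unfolding distr_past_sample[OF t] ..
  also have "\<dots> = (\<integral>\<^sup>+w. \<integral>\<^sup>+s. f (w, s) \<partial>D \<partial>?P)"
    using f by (subst source.nn_integral_fst) auto
  also have "\<dots> \<le> (\<integral>\<^sup>+w. ennreal v \<partial>?P)"
  proof (rule nn_integral_mono)
    fix w assume "w \<in> space ?P"
    then have "y w \<in> X"
      using yX by (simp add: space_F)
    then show "(\<integral>\<^sup>+s. f (w, s) \<partial>D) \<le> ennreal v"
      using nn_integral_eq_integral[OF finite_variance] le_v by (simp add: f_def ennreal_leI)
  qed
  also have "\<dots> = ennreal v"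
    using P.emeasure_space_1 by simp
  finally have le: "(\<integral>\<^sup>+w. ennreal (n w) \<partial>M) \<le> ennreal v" .
  then show int: "integrable M n"
    using n le_less_trans[OF le] by (intro integrableI_nonneg) (auto simp: n_def)
  have "ennreal (expectation n) \<le> ennreal v"
    using le nn_integral_eq_integral[OF int] by (simp add: n_def)
  then show "expectation n \<le> (gradient_sd D X h' F')\<^sup>2"
    using v0 sd by (simp add: ennreal_le_iff)
qed

end

section \<open>Adaptedness of the algorithm in the corrupted model\<close>

locale corrupted_oftrl =
  corrupted_stochastic_model M D Fil X T C G L \<xi> h h' F' c c'
  for M :: "'w measure" and D :: "'s measure" and Fil and X :: "'a::euclidean_space set"
    and T C G L \<xi> h h' F' c c' +
  fixes \<nu> :: real and x g :: "nat \<Rightarrow> 'w \<Rightarrow> 'a"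
  assumes X: "closed X" "bounded X" "convex X" "X \<noteq> {}" and \<nu>: "0 < \<nu>"
    and g: "\<And>t w. g t w = corrupted h' (\<xi> t w) (c' t w) (x t w)"
    and oftrl: "\<And>w. w \<in> space M \<Longrightarrow> adaptive_oftrl X \<nu> T (\<lambda>t. g t w) (\<lambda>t. x t w)"
begin

lemma x_in_X: "w \<in> space M \<Longrightarrow> t \<in> {1..T} \<Longrightarrow> x t w \<in> X"
  using oftrl oftrl_in_set by blast

lemma prediction_measurable:
  assumes "\<And>s. s \<in> {1..<t} \<Longrightarrow> g s \<in> borel_measurable N"
  shows "(\<lambda>w. prediction (\<lambda>s. g s w) t) \<in> borel_measurable N"
  using assms[of "t - 1"] by (cases "t \<le> 1") (auto simp: prediction_def)

lemma step_size_measurable: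
  assumes "\<And>s. s \<in> {1..<t} \<Longrightarrow> g s \<in> borel_measurable N"
  shows "(\<lambda>w. step_size d \<nu> (\<lambda>s. g s w) t) \<in> borel_measurable N"
  using assms
proof (induction t rule: less_induct)
  case (less t)
  have [measurable]: "(\<lambda>w. step_size d \<nu> (\<lambda>s. g s w) s) \<in> borel_measurable N"
    "(\<lambda>w. prediction (\<lambda>s. g s w) s) \<in> borel_measurable N"
    "g s \<in> borel_measurable N" if "s \<in> {1..<t}" for s
    using less that by (auto intro!: prediction_measurable less.IH)
  show ?case
    by (subst step_size.simps) measurable
qed

text \<open>The iterate is a continuous projection of a measurable function of earlier gradients.
  The measurability of these is assumed because iterates and gradients depend on each other
  recursively; the induction in \<open>g_measurable\<close> closes the circle.\<close>

lemma x_measurable_if: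
  assumes t: "t \<in> {1..T}"
    and gm: "\<And>s. s \<in> {1..<t} \<Longrightarrow> g s \<in> borel_measurable (Fil (t - 1))"
  shows "x t \<in> measurable (Fil (t - 1)) (restrict_space borel X)"
proof -
  let ?v = "\<lambda>w. - (step_size (diameter X) \<nu> (\<lambda>s. g s w) t / 2) *\<^sub>R
    (prediction (\<lambda>s. g s w) t + gradient_sum (\<lambda>s. g s w) t)"
  note [measurable] = gm step_size_measurable[OF gm] prediction_measurable[OF gm]
  have "(\<lambda>w. gradient_sum (\<lambda>s. g s w) t) \<in> borel_measurable (Fil (t - 1))"
    unfolding gradient_sum_def by measurable
  then have "?v \<in> borel_measurable (Fil (t - 1))"
    by measurable
  moreover have "closest_point X \<in> borel_measurable borel"
    using X by (intro borel_measurable_continuous_onI continuous_on_closest_point)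
  ultimately have "(\<lambda>w. closest_point X (?v w)) \<in> borel_measurable (Fil (t - 1))"
    by (rule measurable_compose)
  then have "x t \<in> borel_measurable (Fil (t - 1))"
    using oftrl_eq_closest_point[OF X(1-3) \<nu> oftrl t]
    by (subst measurable_cong[where g = "\<lambda>w. closest_point X (?v w)"]) (simp_all add: space_F)
  then show ?thesis
    using x_in_X t by (intro measurable_restrict_space2) (auto simp: space_F)
qed

lemma g_measurable: "t \<in> {1..T} \<Longrightarrow> g t \<in> borel_measurable (Fil t)"
proof (induction t rule: less_induct)
  case (less t)
  have "g s \<in> borel_measurable (Fil (t - 1))" if "s \<in> {1..<t}" for s
    using measurable_Fil_mono[of "g s" s borel "t - 1"] less that by auto
  then have x: "x t \<in> measurable (Fil (t - 1)) (restrict_space borel X)"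
    using less x_measurable_if by blast
  then have "x t \<in> measurable (Fil t) (restrict_space borel X)"
    by (rule measurable_Fil_mono) simp
  then have "(\<lambda>w. h' (x t w) (\<xi> t w)) \<in> borel_measurable (Fil t)"
    using h'_measurable_compose sample_measurable less by blast
  moreover have "(\<lambda>w. c' t w (x t w)) \<in> borel_measurable (Fil t)"
    using measurable_Fil_mono[OF c'_measurable_compose[OF _ x]] less by simp
  ultimately have "(\<lambda>w. h' (x t w) (\<xi> t w) + c' t w (x t w)) \<in> borel_measurable (Fil t)"
    by (rule borel_measurable_add)
  moreover have "g t = (\<lambda>w. h' (x t w) (\<xi> t w) + c' t w (x t w))"
    by (simp add: fun_eq_iff g corrupted_def)
  ultimately show ?case by simp
qed

lemma x_measurable:
  assumes t: "t \<in> {1..T}"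
  shows "x t \<in> measurable (Fil (t - 1)) (restrict_space borel X)"
proof (rule x_measurable_if[OF t])
  fix s assume "s \<in> {1..<t}"
  then show "g s \<in> borel_measurable (Fil (t - 1))"
    using measurable_Fil_mono[OF g_measurable, of s "t - 1"] t by auto
qed

lemma g_bounded: "AE w in M. \<forall>t\<in>{1..T}. norm (g t w) \<le> G"
proof (rule AE_finite_allI)
  fix t assume t: "t \<in> {1..T}"
  show "AE w in M. norm (g t w) \<le> G"
    using loss_gradient_bound[OF t] AE_space by eventually_elim (simp add: g x_in_X[OF _ t])
qed simp

lemma G_nonneg: "0 \<le> G"
proof -
  obtain w where "\<forall>t\<in>{1..T}. norm (g t w) \<le> G"
    using AE_imp_ex[OF g_bounded] by blast
  then have "norm (g 1 w) \<le> G"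
    using horizon by simp
  then show ?thesis
    using norm_ge_zero order_trans by blast
qed

lemma L_nonneg: "0 \<le> L"
  using AE_imp_ex[OF smooth[of 1]] horizon lipschitz_on_nonneg by auto

lemma regret_integrable: "integrable M (\<lambda>w. regret T (\<lambda>t. g t w) (\<lambda>t. x t w) u)"
proof -
  obtain b where b: "norm y \<le> b" if "y \<in> X" for y
    using X by (auto simp: bounded_iff)
  have "integrable M (\<lambda>w. g t w \<bullet> (x t w - u))" if t: "t \<in> {1..T}" for t
  proof (rule integrable_const_bound)
    show "AE w in M. norm (g t w \<bullet> (x t w - u)) \<le> G * (b + norm u)"
      using g_bounded AE_space
    proof eventually_elim
      case (elim w)
      have "norm (g t w \<bullet> (x t w - u)) \<le> norm (g t w) * norm (x t w - u)"
        using Cauchy_Schwarz_ineq2 by simp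
      also have "\<dots> \<le> G * (b + norm u)"
        using elim t b[OF x_in_X[OF _ t]] norm_triangle_ineq4[of "x t w" u] G_nonneg
        by (intro mult_mono) force+
      finally show ?case .
    qed
    have "g t \<in> borel_measurable M"
      using measurable_Fil g_measurable t by blast
    moreover have "x t \<in> borel_measurable M"
      using measurable_Fil[OF x_measurable[OF t]] measurable_restrict_space2_iff by blast
    ultimately show "(\<lambda>w. g t w \<bullet> (x t w - u)) \<in> borel_measurable M"
      by measurable
  qed
  then show ?thesis
    unfolding regret_def by (intro Bochner_Integration.integrable_sum)
qed

section \<open>Noise, drift and variation of the observed gradients\<close>

definition noise :: "nat \<Rightarrow> 'w \<Rightarrow> real" where
  "noise t w = norm (h' (x t w) (\<xi> t w) - F' (x t w))"

text \<open>Both fields are taken at the older iterate, which is fixed before either of the two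
  samples is drawn; at \<open>x t\<close>, which may depend on \<open>\<xi> (t - 1)\<close>, that
  sample would not be fresh.\<close>

definition drift :: "nat \<Rightarrow> 'w \<Rightarrow> real" where
  "drift t w = norm (c' t w (x (t - 1) w) - c' (t - 1) w (x (t - 1) w))"

text \<open>
  The losses of two rounds are bounded at the same point for almost every fresh sample, hence the
  gradients of \<open>c t\<close> and \<open>c (t - 1)\<close> differ by at most \<open>2 * G\<close> there.
\<close>

lemma drift_bounded: "AE w in M. \<forall>t\<in>{2..T}. drift t w \<le> 2 * G"
proof (rule AE_finite_allI)
  fix t assume "t \<in> {2..T}"
  then have t: "t \<in> {1..T}" "t - 1 \<in> {1..T}" by auto
  have 1: "x (t - 1) \<in> measurable (Fil (t - 1)) (restrict_space borel X)"
    by (rule measurable_Fil_mono[OF x_measurable[OF t(2)]]) simp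
  show "AE w in M. drift t w \<le> 2 * G"
    using loss_gradient_bound_fresh[OF t(1) 1] loss_gradient_bound_fresh[OF t(2) x_measurable[OF t(2)]]
  proof eventually_elim
    case (elim w)
    have "AE s in D. norm (h' (x (t - 1) w) s + c' t w (x (t - 1) w)) \<le> G
        \<and> norm (h' (x (t - 1) w) s + c' (t - 1) w (x (t - 1) w)) \<le> G"
      using elim by eventually_elim simp
    from source.AE_imp_ex[OF this] obtain s where "norm (h' (x (t - 1) w) s + c' t w (x (t - 1) w)) \<le> G"
        "norm (h' (x (t - 1) w) s + c' (t - 1) w (x (t - 1) w)) \<le> G"
      by blast
    then show ?case
      using norm_triangle_ineq4[of "h' (x (t - 1) w) s + c' t w (x (t - 1) w)"
          "h' (x (t - 1) w) s + c' (t - 1) w (x (t - 1) w)"]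
      by (simp add: drift_def)
  qed
qed simp

text \<open>One factor of each square is bounded by \<open>2 * G\<close>, the other by the
  corruption sizes of the two rounds, and these add up to at most \<open>2 * C\<close>.\<close>

lemma drift_sum: "AE w in M. (\<Sum>t\<in>{2..T}. (drift t w)\<^sup>2) \<le> 4 * G * C"
  using drift_bounded corruption_level_AE AE_space
proof eventually_elim
  case (elim w)
  let ?m = "\<lambda>t. SUP y\<in>X. norm (c' t w y)"
  have m: "norm (c' t w y) \<le> ?m t" if "t \<in> {1..T}" "y \<in> X" for t y
    using elim that by blast
  have m0: "0 \<le> ?m t" if "t \<in> {1..T}" for t
    using m[OF that] X(4) norm_ge_zero order_trans by blast
  have "(drift t w)\<^sup>2 \<le> 2 * G * (?m t + ?m (t - 1))" if "t \<in> {2..T}" for t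
  proof -
    have t: "t \<in> {1..T}" "t - 1 \<in> {1..T}"
      using that by auto
    have "drift t w \<le> ?m t + ?m (t - 1)"
      unfolding drift_def using elim(3)
      by (intro order_trans[OF norm_triangle_ineq4 add_mono] m t x_in_X)
    then show ?thesis
      unfolding power2_eq_square using elim that G_nonneg
      by (intro mult_mono) (auto simp: drift_def)
  qed
  then have "(\<Sum>t\<in>{2..T}. (drift t w)\<^sup>2) \<le> (\<Sum>t\<in>{2..T}. 2 * G * (?m t + ?m (t - 1)))"
    by (rule sum_mono)
  also have "\<dots> = 2 * G * ((\<Sum>t\<in>{2..T}. ?m t) + (\<Sum>t\<in>{2..T}. ?m (t - 1)))"
    by (simp only: sum_distrib_left[symmetric] sum.distrib)
  also have "\<dots> \<le> 2 * G * (C + C)"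
  proof (intro mult_left_mono add_mono)
    have "(\<Sum>t\<in>{2..T}. ?m t) \<le> (\<Sum>t\<in>{1..T}. ?m t)"
      using m0 by (intro sum_mono2) auto
    then show "(\<Sum>t\<in>{2..T}. ?m t) \<le> C"
      using elim by linarith
    have "(\<Sum>t\<in>{2..T}. ?m (t - 1)) = (\<Sum>t\<in>(\<lambda>t. t - 1) ` {2..T}. ?m t)"
      by (subst sum.reindex) (auto simp: inj_on_def)
    also have "\<dots> \<le> (\<Sum>t\<in>{1..T}. ?m t)"
      using m0 by (intro sum_mono2) auto
    finally show "(\<Sum>t\<in>{2..T}. ?m (t - 1)) \<le> C"
      using elim by linarith
  qed (use G_nonneg in simp)
  finally show ?case by simp
qed

text \<open>Insert the expected gradients of round \<open>t\<close> at both iterates: smoothness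
  compares them within that one round, and only the change of corruption at \<open>x (t - 1)\<close>
  remains.\<close>

lemma gradient_variation:
  "AE w in M. \<forall>t\<in>{2..T}. norm (g t w - g (t - 1) w)
    \<le> noise t w + noise (t - 1) w + L * norm (x t w - x (t - 1) w) + drift t w"
proof (rule AE_finite_allI)
  fix t assume "t \<in> {2..T}"
  then have t: "t \<in> {1..T}" "t - 1 \<in> {1..T}" by auto
  show "AE w in M. norm (g t w - g (t - 1) w)
      \<le> noise t w + noise (t - 1) w + L * norm (x t w - x (t - 1) w) + drift t w"
    using smooth[OF t(1)] AE_space
  proof eventually_elim
    case (elim w)
    let ?y = "x t w" and ?z = "x (t - 1) w"
    have lip: "norm ((F' ?y + c' t w ?y) - (F' ?z + c' t w ?z)) \<le> L * norm (?y - ?z)"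
      using lipschitz_onD[OF elim(1) x_in_X[OF elim(2) t(1)] x_in_X[OF elim(2) t(2)]]
      by (simp add: dist_norm)
    have "g t w - g (t - 1) w = ((h' ?y (\<xi> t w) - F' ?y) - (h' ?z (\<xi> (t - 1) w) - F' ?z))
        + ((F' ?y + c' t w ?y) - (F' ?z + c' t w ?z)) + (c' t w ?z - c' (t - 1) w ?z)"
      by (simp add: g corrupted_def)
    also have "norm \<dots> \<le> (noise t w + noise (t - 1) w) + L * norm (?y - ?z) + drift t w"
      unfolding noise_def drift_def
      by (intro norm_triangle_mono norm_triangle_ineq4 lip order_refl)
    finally show ?case .
  qed
qed simp

lemma noise_sum:
  shows "integrable M (\<lambda>w. \<Sum>t\<in>{1..T}. (noise t w)\<^sup>2)"
    and "expectation (\<lambda>w. \<Sum>t\<in>{1..T}. (noise t w)\<^sup>2) \<le> real T * (gradient_sd D X h' F')\<^sup>2"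
proof -
  have int: "integrable M (\<lambda>w. (noise t w)\<^sup>2)"
    and le: "expectation (\<lambda>w. (noise t w)\<^sup>2) \<le> (gradient_sd D X h' F')\<^sup>2" if "t \<in> {1..T}" for t
    unfolding noise_def using noise_variance[OF X(2) that x_measurable[OF that]] by auto
  show "integrable M (\<lambda>w. \<Sum>t\<in>{1..T}. (noise t w)\<^sup>2)"
    using int by (intro Bochner_Integration.integrable_sum)
  have "expectation (\<lambda>w. \<Sum>t\<in>{1..T}. (noise t w)\<^sup>2) = (\<Sum>t\<in>{1..T}. expectation (\<lambda>w. (noise t w)\<^sup>2))"
    using int by (intro Bochner_Integration.integral_sum)
  also have "\<dots> \<le> (\<Sum>t\<in>{1..T}. (gradient_sd D X h' F')\<^sup>2)"
    using le by (intro sum_mono)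
  finally show "expectation (\<lambda>w. \<Sum>t\<in>{1..T}. (noise t w)\<^sup>2) \<le> real T * (gradient_sd D X h' F')\<^sup>2"
    by simp
qed

lemma gradient_sd_nonneg: "0 \<le> gradient_sd D X h' F'"
proof -
  obtain y where y: "y \<in> X"
    using X by blast
  have "0 \<le> (\<integral>s. (norm (h' y s - F' y))\<^sup>2 \<partial>D)" by simp
  also have "\<dots> \<le> (SUP y\<in>X. \<integral>s. (norm (h' y s - F' y))\<^sup>2 \<partial>D)"
    using y bdd_above_variance[OF X(2)] by (intro cSUP_upper)
  finally show ?thesis
    by (simp add: gradient_sd_def)
qed

section \<open>Expected regret\<close>

text \<open>Takes expectations in \<open>oftrl_regret_le_noise\<close>, with Jensen for the noise.
  The radius \<open>SUP y\<in>X. norm y\<close> replaces \<open>norm u\<close> to make the constants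
  independent of \<open>u\<close>.\<close>

lemma expected_regret_le:
  assumes u: "u \<in> X" and d0: "0 < diameter X"
  defines "d \<equiv> diameter X" and "k \<equiv> ((SUP y\<in>X. norm y) / diameter X)\<^sup>2 + 1"
  shows "expectation (\<lambda>w. regret T (\<lambda>t. g t w) (\<lambda>t. x t w) u)
    \<le> 8 * k * (d * gradient_sd D X h' F' * sqrt (real T) + d * sqrt (G * C))
      + (k * (\<nu> + 4 * d\<^sup>2 * G\<^sup>2 / \<nu> + 2 * d * G) + 16 * k\<^sup>2 * d ^ 4 * L\<^sup>2 / \<nu>)"
proof -
  let ?N = "\<lambda>w. \<Sum>t\<in>{1..T}. (noise t w)\<^sup>2"
  define K' where "K' = k * (\<nu> + 4 * d\<^sup>2 * G\<^sup>2 / \<nu> + 2 * d * G) + 16 * k\<^sup>2 * d ^ 4 * L\<^sup>2 / \<nu>"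
  have u_le: "norm u \<le> (SUP y\<in>X. norm y)"
    using u X(2) by (intro cSUP_upper) (auto simp: bounded_iff bdd_above_def)
  have N0: "0 \<le> ?N w" for w
    by (simp add: sum_nonneg)
  note sq = expectation_sqrt_le[OF noise_sum(1) N0]
  have bd: "AE w in M. regret T (\<lambda>t. g t w) (\<lambda>t. x t w) u \<le> 8 * k * d * (sqrt (?N w) + sqrt (G * C)) + K'"
    using g_bounded drift_sum gradient_variation AE_space
  proof eventually_elim
    case (elim w)
    show ?case
      unfolding d_def k_def K'_def
      using elim corruption_pos
      by (intro oftrl_regret_le_noise[OF X(1-3) d0 \<nu> horizon oftrl[OF elim(4)] u u_le G_nonneg _ L_nonneg,
            where e = "\<lambda>t. drift t w"]) auto
  qed
  have "expectation (\<lambda>w. regret T (\<lambda>t. g t w) (\<lambda>t. x t w) u)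
      \<le> expectation (\<lambda>w. 8 * k * d * (sqrt (?N w) + sqrt (G * C)) + K')"
    using sq(1) by (intro integral_mono_AE regret_integrable bd) simp
  also have "\<dots> = 8 * k * d * (expectation (\<lambda>w. sqrt (?N w)) + sqrt (G * C)) + K'"
    using sq(1) prob_space by simp
  also have "\<dots> \<le> 8 * k * d * (gradient_sd D X h' F' * sqrt (real T) + sqrt (G * C)) + K'"
  proof (intro add_right_mono mult_left_mono)
    have "expectation (\<lambda>w. sqrt (?N w)) \<le> sqrt (real T * (gradient_sd D X h' F')\<^sup>2)"
      using sq(2) noise_sum(2) by (meson order_trans real_sqrt_le_mono)
    then show "expectation (\<lambda>w. sqrt (?N w)) \<le> gradient_sd D X h' F' * sqrt (real T)"
      using gradient_sd_nonneg by (simp add: real_sqrt_mult mult.commute)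
    show "0 \<le> 8 * k * d"
      using d0 by (simp add: k_def d_def)
  qed
  finally show ?thesis
    by (simp add: K'_def algebra_simps)
qed

text \<open>In these cases the quotient defining the multiplicative constant of the final bound has
  denominator 0, so they need the exact value.\<close>

lemma expected_regret_degenerate:
  assumes u: "u \<in> X" and "diameter X = 0 \<or> G = 0"
  shows "expectation (\<lambda>w. regret T (\<lambda>t. g t w) (\<lambda>t. x t w) u) = 0"
proof -
  have "AE w in M. regret T (\<lambda>t. g t w) (\<lambda>t. x t w) u = 0"
    using g_bounded AE_space
  proof eventually_elim
    case (elim w)
    have "g t w \<bullet> (x t w - u) = 0" if t: "t \<in> {1..T}" for t
    proof (cases "diameter X = 0")
      case True
      then have "dist (x t w) u \<le> 0"
        using diameter_bounded_bound[OF X(2) x_in_X[OF elim(2) t] u] by simp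
      then show ?thesis by simp
    next
      case False
      then have "norm (g t w) \<le> 0"
        using elim(1) t assms(2) by auto
      then show ?thesis by simp
    qed
    then show ?case
      by (simp add: regret_def)
  qed
  then show ?thesis
    by (subst integral_cong_AE[where g = "\<lambda>_. 0"])
      (auto intro: borel_measurable_integrable regret_integrable)
qed

end

section \<open>Uniform constants for the final bound\<close>

text \<open>The O-notation is read in two ways: with an additive constant \<open>K'\<close> for all
  corruption levels, and purely multiplicatively once \<open>C\<close> is at least
  \<open>C\<^sub>0\<close>. All constants precede the model, so they depend on neither the horizon
  nor the variance. The ratio of radius to diameter enters because the regulariser is centred at the
  origin. Integrability is asserted since a non-integrable function has integral 0 by
  convention.\<close>

theorem corollary9:
  shows "\<exists>K :: real \<Rightarrow> real.
    \<forall>(X :: 'a::euclidean_space set) G L \<nu>.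
      closed X \<and> bounded X \<and> convex X \<and> X \<noteq> {} \<and> 0 < \<nu> \<longrightarrow>
      (\<exists>K'. \<forall>C\<^sub>0 > 0. \<exists>K''.
        \<forall>(M :: 'w measure) (D :: 's measure) Fil T C \<xi> h h' F' c c' x g u.
          corrupted_stochastic_model M D Fil X T C G L \<xi> h h' F' c c' \<and>
          (\<forall>t w. g t w = corrupted h' (\<xi> t w) (c' t w) (x t w)) \<and>
          (\<forall>w\<in>space M. adaptive_oftrl X \<nu> T (\<lambda>t. g t w) (\<lambda>t. x t w)) \<and>
          u \<in> X \<longrightarrow>
          (let R = (\<lambda>w. regret T (\<lambda>t. g t w) (\<lambda>t. x t w) u);
               B = diameter X * gradient_sd D X h' F' * sqrt (real T)
                   + diameter X * sqrt (G * C)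
           in integrable M R \<and>
              (\<integral>w. R w \<partial>M) \<le> K ((SUP y\<in>X. norm y) / diameter X) * B + K' \<and>
              (C\<^sub>0 \<le> C \<longrightarrow> (\<integral>w. R w \<partial>M) \<le> K'' * B)))"
proof (intro exI[of _ "\<lambda>\<rho>. 8 * (\<rho>\<^sup>2 + 1)"] allI impI, elim conjE)
  fix X :: "'a set" and G L \<nu> :: real
  assume X: "closed X" "bounded X" "convex X" "X \<noteq> {}" and \<nu>: "0 < \<nu>"
  define d where "d = diameter X"
  define k where "k = ((SUP y\<in>X. norm y) / d)\<^sup>2 + 1"
  \<comment> \<open>The absolute value keeps \<open>K'\<close> nonnegative: the sign of
    \<open>G\<close> is known only once a model is given.\<close>
  define K' where "K' = k * (\<nu> + 4 * d\<^sup>2 * G\<^sup>2 / \<nu> + 2 * d * \<bar>G\<bar>) + 16 * k\<^sup>2 * d ^ 4 * L\<^sup>2 / \<nu>"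
  have d: "0 \<le> d"
    using X by (simp add: d_def diameter_ge_0)
  have k: "0 \<le> k"
    by (simp add: k_def)
  have K': "0 \<le> K'"
    unfolding K'_def using d k \<nu> by (intro add_nonneg_nonneg mult_nonneg_nonneg divide_nonneg_nonneg) auto
  have bound: "integrable M (\<lambda>w. regret T (\<lambda>t. g t w) (\<lambda>t. x t w) u) \<and>
      (\<integral>w. regret T (\<lambda>t. g t w) (\<lambda>t. x t w) u \<partial>M)
        \<le> 8 * k * (d * gradient_sd D X h' F' * sqrt (real T) + d * sqrt (G * C)) + K' \<and>
      (C\<^sub>0 \<le> C \<longrightarrow> (\<integral>w. regret T (\<lambda>t. g t w) (\<lambda>t. x t w) u \<partial>M)
        \<le> (8 * k + K' / (d * sqrt (G * C\<^sub>0))) * (d * gradient_sd D X h' F' * sqrt (real T) + d * sqrt (G * C)))"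
    if C\<^sub>0: "0 < C\<^sub>0" and model: "corrupted_stochastic_model M D Fil X T C G L \<xi> h h' F' c c'"
      and g: "\<forall>t w. g t w = corrupted h' (\<xi> t w) (c' t w) (x t w)"
      and oftrl: "\<forall>w\<in>space M. adaptive_oftrl X \<nu> T (\<lambda>t. g t w) (\<lambda>t. x t w)" and u: "u \<in> X"
    for C\<^sub>0 C u and M :: "'w measure" and D :: "'s measure" and Fil T \<xi> h h' F' c c' x g
  proof -
    interpret corrupted_oftrl M D Fil X T C G L \<xi> h h' F' c c' \<nu> x g
      using model X \<nu> g oftrl
      by (auto simp: corrupted_oftrl_def corrupted_oftrl_axioms_def)
    let ?R = "\<lambda>w. regret T (\<lambda>t. g t w) (\<lambda>t. x t w) u"
    define B where "B = d * gradient_sd D X h' F' * sqrt (real T) + d * sqrt (G * C)"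
    have B_ge: "d * sqrt (G * C) \<le> B"
      using d gradient_sd_nonneg by (simp add: B_def)
    have B: "0 \<le> B"
      using d gradient_sd_nonneg G_nonneg corruption_pos by (simp add: B_def)
    have "(\<integral>w. ?R w \<partial>M) \<le> 8 * k * B + K' \<and>
        (C\<^sub>0 \<le> C \<longrightarrow> (\<integral>w. ?R w \<partial>M) \<le> (8 * k + K' / (d * sqrt (G * C\<^sub>0))) * B)"
    proof (cases "d = 0 \<or> G = 0")
      \<comment> \<open>Here the quotient by \<open>d * sqrt (G * C\<^sub>0)\<close> is 0 by
        convention, and nonnegative right-hand sides suffice.\<close>
      case True
      then have "(\<integral>w. ?R w \<partial>M) = 0"
        using expected_regret_degenerate[OF u] by (simp add: d_def)
      then show ?thesis
        using k K' B d G_nonneg C\<^sub>0 by simp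
    next
      case False
      then have pos: "0 < d" "0 < G"
        using d G_nonneg by auto
      have 1: "(\<integral>w. ?R w \<partial>M) \<le> 8 * k * B + K'"
        using expected_regret_le[OF u] pos by (simp add: B_def K'_def k_def d_def)
      \<comment> \<open>For \<open>C\<^sub>0 \<le> C\<close> the positive number
        \<open>d * sqrt (G * C\<^sub>0)\<close> is a lower bound for \<open>B\<close>, so
        \<open>K'\<close> is at most a fixed multiple of \<open>B\<close>.\<close>
      have "(\<integral>w. ?R w \<partial>M) \<le> (8 * k + K' / (d * sqrt (G * C\<^sub>0))) * B" if "C\<^sub>0 \<le> C"
      proof -
        have "d * sqrt (G * C\<^sub>0) \<le> d * sqrt (G * C)"
          using pos that by simp
        then have "K' * (d * sqrt (G * C\<^sub>0)) \<le> K' * B"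
          using K' B_ge by (intro mult_left_mono) auto
        then have "K' \<le> K' / (d * sqrt (G * C\<^sub>0)) * B"
          using pos C\<^sub>0 by (simp add: pos_le_divide_eq)
        then show ?thesis
          using 1 by (simp add: distrib_right)
      qed
      then show ?thesis
        using 1 by blast
    qed
    then show ?thesis
      using regret_integrable unfolding B_def by blast
  qed
  show "\<exists>K'. \<forall>C\<^sub>0 > 0. \<exists>K''.
        \<forall>(M :: 'w measure) (D :: 's measure) Fil T C \<xi> h h' F' c c' x g u.
          corrupted_stochastic_model M D Fil X T C G L \<xi> h h' F' c c' \<and>
          (\<forall>t w. g t w = corrupted h' (\<xi> t w) (c' t w) (x t w)) \<and>
          (\<forall>w\<in>space M. adaptive_oftrl X \<nu> T (\<lambda>t. g t w) (\<lambda>t. x t w)) \<and>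
          u \<in> X \<longrightarrow>
          (let R = (\<lambda>w. regret T (\<lambda>t. g t w) (\<lambda>t. x t w) u);
               B = diameter X * gradient_sd D X h' F' * sqrt (real T)
                   + diameter X * sqrt (G * C)
           in integrable M R \<and>
              (\<integral>w. R w \<partial>M) \<le> 8 * (((SUP y\<in>X. norm y) / diameter X)\<^sup>2 + 1) * B + K' \<and>
              (C\<^sub>0 \<le> C \<longrightarrow> (\<integral>w. R w \<partial>M) \<le> K'' * B))"
    unfolding Let_def d_def[symmetric] k_def[symmetric]
    by (rule exI[of _ K'], intro allI impI, rule exI[of _ "8 * k + K' / (d * sqrt (G * _))"],
        intro allI impI, elim conjE, rule bound)
qed

end
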